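(* Let $\phi: T \to T'$ be a theory translation between first-order theories, and let $F: \mathbf{Th} \to \mathbf{Mod}$ and $G: \mathbf{Th} \to \mathbf{Mod}$ be the functors defined via the Henkin construction and the compactness (or saturation) construction, respectively. Assume that $F$ and $G$ satisfy the well-definedness and structure-preservation properties of their constructions (as listed in the context). Then the natural transformation $$\eta: F \Rightarrow G,\quad \text{where } \eta_T([t]) = \llbracket t \rrbracket_{G(T)}$$ for each theory $T$ and term $t$, is natural; that is, $$\eta_{T'} \circ F(\phi) = G(\phi) \circ \eta_T.$$
   Context: Objects of $\mathbf{Th}$ are first-order theories $(\Sigma,T)$, where $\Sigma$ is a signature (constant, function and predicate symbols) and $T$ is a set of sentences in $L_\Sigma$, denoted simply $T$; the theories are taken to be consistent. A morphism (theory translation) $\phi:(\Sigma,T)\to(\Sigma',T')$ assigns to each symbol of $\Sigma$ a corresponding symbol of $\Sigma'$ so that, for every sentence $\varphi$ of $L_\Sigma$, $T\vdash\varphi$ implies $T'\vdash\phi(\varphi)$. An object of $\mathbf{Mod}$ is a model $\mathcal M=(M,\{f^{\mathcal M}\},\{P^{\mathcal M}\})$, $M\neq\varnothing$, of a first-order theory; a morphism is a function $h$ between domains that commutes with the interpretations of function symbols and maps tuples in $P^{\mathcal M}$ to tuples in $P^{\mathcal N}$. Functor $F$: for a consistent theory $T$ in a language $\mathcal L$, let $\mathcal L^*$ be obtained by adding a new constant $c_\varphi$ for every formula $\varphi(x)$ with one free variable. $T^*$ is a maximal consistent theory in $\mathcal L^*$ extending $T$ such that if $T\vdash\exists x\,\varphi(x)$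 then $T^*\vdash\varphi(c_\varphi)$. $\mathrm{Term}(T^* )$ is the set of closed $\mathcal L^*$-terms, $t\sim_T s\iff T^*\vdash t=s$, $[t]$ is the class of $t$, and $F(T):=\mathrm{Term}(T^* )/\sim_T$ with structure induced by the syntactic operations. Functor $G$: $G(T)$ is a model of $T$ obtained either as an ultraproduct $\prod_{i\in I}M_i/\mathcal U$, where each $M_i$ is a model of some finite subset of $T$ and $\mathcal U$ is a non-principal ultrafilter on $I$, or as a $\kappa$-saturated model of $T$ for a sufficiently large cardinal $\kappa$; the construction is assumed canonical, in the sense that any two models so obtained are isomorphic. $\llbracket t\rrbracket_{G(T)}$ is the interpretation of the term $t$ in $G(T)$. Well-definedness and structure-preservation properties. For $F$: every translation $\phi:T\to T'$ extends to a map of terms $\mathrm{Term}(T^* )\to\mathrm{Term}(T'^* )$ such that $t\sim_T s$ implies $\phi(t)\sim_{T'}\phi(s)$; $F(\phi)([t]):=[\phi(t)]$ is well-defined; and $F$ preserves identities and composition. For $G$: the assignment $G(\phi)(\llbracket t\rrbracket_{G(T)}):=\llbracket\phi(t)\rrbracket_{G(T')}$ for all terms $t$ is well-defined, preserves the structure determined by the semantic evaluations, and respects composition.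
   Formalization: Th is replaced by any category of consistent theories and translations, since the properties of F cannot hold on all of Th; and the new constants are assumed interpreted in G(T) so that T* holds there, without which η need not be well defined. *)

theory Defs
  imports Main "HOL-Library.FuncSet"
begin

unbundle cardinal_syntax

section \<open>First-order syntax\<close>

text \<open>
  The types \<open>'f\<close> and \<open>'p\<close> are the pools from which signatures draw their function and predicate
  symbols; constants are function symbols of arity \<open>0\<close>. Variables are de Bruijn indices.
\<close>

record ('f, 'p) signature =
  fun_ar :: "'f \<Rightarrow> nat option"
  rel_ar :: "'p \<Rightarrow> nat option"

datatype 'f tm = Var nat | Fn 'f "'f tm list"

datatype ('f, 'p) fm =
    Falsum
  | Eq "'f tm" "'f tm"
  | Rel 'p "'f tm list"
  | Imp "('f, 'p) fm" "('f, 'p) fm"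
  | Forall "('f, 'p) fm"

definition Neg :: "('f, 'p) fm \<Rightarrow> ('f, 'p) fm" where
  "Neg \<phi> = Imp \<phi> Falsum"

definition Exists :: "('f, 'p) fm \<Rightarrow> ('f, 'p) fm" where
  "Exists \<phi> = Neg (Forall (Neg \<phi>))"

primrec wf_tm :: "('f, 'p) signature \<Rightarrow> 'f tm \<Rightarrow> bool" where
  "wf_tm \<Sigma> (Var n) \<longleftrightarrow> True"
| "wf_tm \<Sigma> (Fn f ts) \<longleftrightarrow> fun_ar \<Sigma> f = Some (length ts) \<and> list_all (wf_tm \<Sigma>) ts"

primrec wf_fm :: "('f, 'p) signature \<Rightarrow> ('f, 'p) fm \<Rightarrow> bool" where
  "wf_fm \<Sigma> Falsum \<longleftrightarrow> True"
| "wf_fm \<Sigma> (Eq s t) \<longleftrightarrow> wf_tm \<Sigma> s \<and> wf_tm \<Sigma> t"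
| "wf_fm \<Sigma> (Rel P ts) \<longleftrightarrow> rel_ar \<Sigma> P = Some (length ts) \<and> list_all (wf_tm \<Sigma>) ts"
| "wf_fm \<Sigma> (Imp \<phi> \<psi>) \<longleftrightarrow> wf_fm \<Sigma> \<phi> \<and> wf_fm \<Sigma> \<psi>"
| "wf_fm \<Sigma> (Forall \<phi>) \<longleftrightarrow> wf_fm \<Sigma> \<phi>"

primrec fv_tm :: "'f tm \<Rightarrow> nat set" where
  "fv_tm (Var n) = {n}"
| "fv_tm (Fn f ts) = \<Union> (set (map fv_tm ts))"

primrec fv_fm :: "('f, 'p) fm \<Rightarrow> nat set" where
  "fv_fm Falsum = {}"
| "fv_fm (Eq s t) = fv_tm s \<union> fv_tm t"
| "fv_fm (Rel P ts) = \<Union> (set (map fv_tm ts))"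
| "fv_fm (Imp \<phi> \<psi>) = fv_fm \<phi> \<union> fv_fm \<psi>"
| "fv_fm (Forall \<phi>) = {n. Suc n \<in> fv_fm \<phi>}"

definition closed_terms :: "('f, 'p) signature \<Rightarrow> 'f tm set" where
  "closed_terms \<Sigma> = {t. wf_tm \<Sigma> t \<and> fv_tm t = {}}"

definition sentences :: "('f, 'p) signature \<Rightarrow> ('f, 'p) fm set" where
  "sentences \<Sigma> = {\<phi>. wf_fm \<Sigma> \<phi> \<and> fv_fm \<phi> = {}}"

primrec subst_tm :: "(nat \<Rightarrow> 'f tm) \<Rightarrow> 'f tm \<Rightarrow> 'f tm" where
  "subst_tm \<theta> (Var n) = \<theta> n"
| "subst_tm \<theta> (Fn f ts) = Fn f (map (subst_tm \<theta>) ts)"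

definition lift_tm :: "'f tm \<Rightarrow> 'f tm" where
  "lift_tm = subst_tm (\<lambda>n. Var (Suc n))"

primrec subst_fm :: "(nat \<Rightarrow> 'f tm) \<Rightarrow> ('f, 'p) fm \<Rightarrow> ('f, 'p) fm" where
  "subst_fm \<theta> Falsum = Falsum"
| "subst_fm \<theta> (Eq s t) = Eq (subst_tm \<theta> s) (subst_tm \<theta> t)"
| "subst_fm \<theta> (Rel P ts) = Rel P (map (subst_tm \<theta>) ts)"
| "subst_fm \<theta> (Imp \<phi> \<psi>) = Imp (subst_fm \<theta> \<phi>) (subst_fm \<theta> \<psi>)"
| "subst_fm \<theta> (Forall \<phi>) = Forall (subst_fm (case_nat (Var 0) (\<lambda>n. lift_tm (\<theta> n))) \<phi>)"

definition lift_fm :: "('f, 'p) fm \<Rightarrow> ('f, 'p) fm" where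
  "lift_fm = subst_fm (\<lambda>n. Var (Suc n))"

text \<open>\<open>inst \<phi> t\<close> is \<open>\<phi>(t)\<close>: the outermost variable \<open>0\<close> is replaced by \<open>t\<close>.\<close>

definition inst :: "('f, 'p) fm \<Rightarrow> 'f tm \<Rightarrow> ('f, 'p) fm" where
  "inst \<phi> t = subst_fm (case_nat t Var) \<phi>"


section \<open>Provability\<close>

text \<open>
  Classical natural deduction with equality. Derivations stay inside the language of the
  signature \<open>\<Sigma>\<close>.
\<close>

inductive derives :: "('f, 'p) signature \<Rightarrow> ('f, 'p) fm set \<Rightarrow> ('f, 'p) fm \<Rightarrow> bool"
  for \<Sigma> :: "('f, 'p) signature" where
  Assm: "\<phi> \<in> \<Gamma> \<Longrightarrow> wf_fm \<Sigma> \<phi> \<Longrightarrow> derives \<Sigma> \<Gamma> \<phi>"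
| ImpI: "wf_fm \<Sigma> \<phi> \<Longrightarrow> derives \<Sigma> (insert \<phi> \<Gamma>) \<psi> \<Longrightarrow> derives \<Sigma> \<Gamma> (Imp \<phi> \<psi>)"
| ImpE: "derives \<Sigma> \<Gamma> (Imp \<phi> \<psi>) \<Longrightarrow> derives \<Sigma> \<Gamma> \<phi> \<Longrightarrow> derives \<Sigma> \<Gamma> \<psi>"
| RAA: "wf_fm \<Sigma> \<phi> \<Longrightarrow> derives \<Sigma> (insert (Neg \<phi>) \<Gamma>) Falsum \<Longrightarrow> derives \<Sigma> \<Gamma> \<phi>"
| ForallI: "derives \<Sigma> (lift_fm ` \<Gamma>) \<phi> \<Longrightarrow> derives \<Sigma> \<Gamma> (Forall \<phi>)"
| ForallE: "derives \<Sigma> \<Gamma> (Forall \<phi>) \<Longrightarrow> wf_tm \<Sigma> t \<Longrightarrow> derives \<Sigma> \<Gamma> (inst \<phi> t)"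
| EqI: "wf_tm \<Sigma> t \<Longrightarrow> derives \<Sigma> \<Gamma> (Eq t t)"
| EqE: "derives \<Sigma> \<Gamma> (Eq s t) \<Longrightarrow> wf_fm \<Sigma> \<phi> \<Longrightarrow> derives \<Sigma> \<Gamma> (inst \<phi> s) \<Longrightarrow> derives \<Sigma> \<Gamma> (inst \<phi> t)"

definition consistent :: "('f, 'p) signature \<Rightarrow> ('f, 'p) fm set \<Rightarrow> bool" where
  "consistent \<Sigma> T \<longleftrightarrow> \<not> derives \<Sigma> T Falsum"

definition maximal_consistent :: "('f, 'p) signature \<Rightarrow> ('f, 'p) fm set \<Rightarrow> bool" where
  "maximal_consistent \<Sigma> T \<longleftrightarrow> T \<subseteq> sentences \<Sigma> \<and> consistent \<Sigma> T \<and>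
     (\<forall>T'. T \<subseteq> T' \<and> T' \<subseteq> sentences \<Sigma> \<and> consistent \<Sigma> T' \<longrightarrow> T' = T)"


section \<open>The category of theories\<close>

type_synonym ('f, 'p) fo_theory = "('f, 'p) signature \<times> ('f, 'p) fm set"

record ('f, 'p) translation =
  on_fun :: "'f \<Rightarrow> 'f"
  on_rel :: "'p \<Rightarrow> 'p"

type_synonym ('f, 'p) th_arrow =
  "('f, 'p) fo_theory \<times> ('f, 'p) translation \<times> ('f, 'p) fo_theory"

definition translate :: "('f, 'p) translation \<Rightarrow> ('f, 'p) fm \<Rightarrow> ('f, 'p) fm" where
  "translate \<phi> = map_fm (on_fun \<phi>) (on_rel \<phi>)"

definition id_translation :: "('f, 'p) translation" where
  "id_translation = \<lparr>on_fun = id, on_rel = id\<rparr>"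

definition comp_translation ::
  "('f, 'p) translation \<Rightarrow> ('f, 'p) translation \<Rightarrow> ('f, 'p) translation" where
  "comp_translation \<psi> \<phi> = \<lparr>on_fun = on_fun \<psi> \<circ> on_fun \<phi>, on_rel = on_rel \<psi> \<circ> on_rel \<phi>\<rparr>"

definition Th_object :: "('f, 'p) fo_theory \<Rightarrow> bool" where
  "Th_object = (\<lambda>(\<Sigma>, T). T \<subseteq> sentences \<Sigma> \<and> consistent \<Sigma> T)"

definition Th_morphism :: "('f, 'p) th_arrow \<Rightarrow> bool" where
  "Th_morphism = (\<lambda>((\<Sigma>, T), \<phi>, (\<Sigma>', T')).
     (\<forall>f n. fun_ar \<Sigma> f = Some n \<longrightarrow> fun_ar \<Sigma>' (on_fun \<phi> f) = Some n) \<and>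
     (\<forall>P n. rel_ar \<Sigma> P = Some n \<longrightarrow> rel_ar \<Sigma>' (on_rel \<phi> P) = Some n) \<and>
     (\<forall>\<sigma> \<in> sentences \<Sigma>. derives \<Sigma> T \<sigma> \<longrightarrow> derives \<Sigma>' T' (translate \<phi> \<sigma>)))"

text \<open>
  The properties required of the Henkin and compactness constructions cannot hold on all theories
  and translations at once. For instance, if \<open>T\<close> is axiomatised by \<open>c = d \<or> e = f\<close> then \<open>T\<^sup>*\<close>
  proves one of the two disjuncts, say \<open>c = d\<close>, so that no extension of the inclusion of \<open>T\<close> into
  \<open>T \<union> {c \<noteq> d}\<close> respects the provable equality of terms. The category of theories is
  therefore an arbitrary category of (consistent) theories and translations, given by its set
  \<open>Ob\<close> of objects and its set \<open>Ar\<close> of arrows; all theories and all translations is one instance.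
\<close>

definition subcategory_of_Th :: "('f, 'p) fo_theory set \<Rightarrow> ('f, 'p) th_arrow set \<Rightarrow> bool" where
  "subcategory_of_Th Ob Ar \<longleftrightarrow>
     (\<forall>\<T> \<in> Ob. Th_object \<T> \<and> (\<T>, id_translation, \<T>) \<in> Ar) \<and>
     (\<forall>\<T> \<phi> \<T>'. (\<T>, \<phi>, \<T>') \<in> Ar \<longrightarrow> \<T> \<in> Ob \<and> \<T>' \<in> Ob \<and> Th_morphism (\<T>, \<phi>, \<T>')) \<and>
     (\<forall>\<T> \<phi> \<T>' \<psi> \<T>''. (\<T>, \<phi>, \<T>') \<in> Ar \<and> (\<T>', \<psi>, \<T>'') \<in> Ar \<longrightarrow>
        (\<T>, comp_translation \<psi> \<phi>, \<T>'') \<in> Ar)"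


section \<open>The category of models\<close>

record ('f, 'p, 'm) fo_struct =
  universe :: "'m set"
  fun_int :: "'f \<Rightarrow> 'm list \<Rightarrow> 'm"
  rel_int :: "'p \<Rightarrow> 'm list \<Rightarrow> bool"

definition tuples :: "('f, 'p, 'm) fo_struct \<Rightarrow> nat \<Rightarrow> 'm list set" where
  "tuples M n = {xs. length xs = n \<and> set xs \<subseteq> universe M}"

definition is_struct :: "('f, 'p) signature \<Rightarrow> ('f, 'p, 'm) fo_struct \<Rightarrow> bool" where
  "is_struct \<Sigma> M \<longleftrightarrow> universe M \<noteq> {} \<and>
     (\<forall>f n. fun_ar \<Sigma> f = Some n \<longrightarrow> (\<forall>xs \<in> tuples M n. fun_int M f xs \<in> universe M))"

primrec eval :: "('f, 'p, 'm) fo_struct \<Rightarrow> (nat \<Rightarrow> 'm) \<Rightarrow> 'f tm \<Rightarrow> 'm" where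
  "eval M e (Var n) = e n"
| "eval M e (Fn f ts) = fun_int M f (map (eval M e) ts)"

primrec sat :: "('f, 'p, 'm) fo_struct \<Rightarrow> (nat \<Rightarrow> 'm) \<Rightarrow> ('f, 'p) fm \<Rightarrow> bool" where
  "sat M e Falsum \<longleftrightarrow> False"
| "sat M e (Eq s t) \<longleftrightarrow> eval M e s = eval M e t"
| "sat M e (Rel P ts) \<longleftrightarrow> rel_int M P (map (eval M e) ts)"
| "sat M e (Imp \<phi> \<psi>) \<longleftrightarrow> (sat M e \<phi> \<longrightarrow> sat M e \<psi>)"
| "sat M e (Forall \<phi>) \<longleftrightarrow> (\<forall>x \<in> universe M. sat M (case_nat x e) \<phi>)"

text \<open>The environment is irrelevant for closed terms.\<close>

definition denotation :: "('f, 'p, 'm) fo_struct \<Rightarrow> 'f tm \<Rightarrow> 'm" where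
  "denotation M t = eval M (\<lambda>_. undefined) t"

definition is_model :: "('f, 'p) fo_theory \<Rightarrow> ('f, 'p, 'm) fo_struct \<Rightarrow> bool" where
  "is_model = (\<lambda>(\<Sigma>, T) M. is_struct \<Sigma> M \<and>
     (\<forall>\<sigma> \<in> T. \<forall>e. range e \<subseteq> universe M \<longrightarrow> sat M e \<sigma>))"

definition Mod_object :: "('f, 'p) signature \<Rightarrow> ('f, 'p, 'm) fo_struct \<Rightarrow> bool" where
  "Mod_object \<Sigma> M \<longleftrightarrow> (\<exists>T. Th_object (\<Sigma>, T) \<and> is_model (\<Sigma>, T) M)"

text \<open>
  A morphism between models of theories over different signatures has to match each symbol of the
  source signature with a symbol of the target one; the matching is given by a translation \<open>\<phi>\<close>.
  Between models over the same signature, \<open>\<phi>\<close> is the identity and this is the usual notion of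
  homomorphism.
\<close>

definition Mod_morphism ::
  "('f, 'p) signature \<Rightarrow> ('f, 'p) translation \<Rightarrow> ('f, 'p, 'm) fo_struct \<Rightarrow> ('f, 'p, 'n) fo_struct \<Rightarrow>
   ('m \<Rightarrow> 'n) \<Rightarrow> bool" where
  "Mod_morphism \<Sigma> \<phi> M N h \<longleftrightarrow> h ` universe M \<subseteq> universe N \<and>
     (\<forall>f n. fun_ar \<Sigma> f = Some n \<longrightarrow>
        (\<forall>xs \<in> tuples M n. h (fun_int M f xs) = fun_int N (on_fun \<phi> f) (map h xs))) \<and>
     (\<forall>P n. rel_ar \<Sigma> P = Some n \<longrightarrow>
        (\<forall>xs \<in> tuples M n. rel_int M P xs \<longrightarrow> rel_int N (on_rel \<phi> P) (map h xs)))"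

definition isomorphic ::
  "('f, 'p) signature \<Rightarrow> ('f, 'p, 'm) fo_struct \<Rightarrow> ('f, 'p, 'n) fo_struct \<Rightarrow> bool" where
  "isomorphic \<Sigma> M N \<longleftrightarrow> (\<exists>h. bij_betw h (universe M) (universe N) \<and>
     Mod_morphism \<Sigma> id_translation M N h \<and>
     Mod_morphism \<Sigma> id_translation N M (the_inv_into (universe M) h))"

definition functor_to_Mod ::
  "('f, 'p) fo_theory set \<Rightarrow> ('f, 'p) th_arrow set \<Rightarrow>
   (('f, 'p) fo_theory \<Rightarrow> ('f, 'p, 'm) fo_struct) \<Rightarrow> (('f, 'p) th_arrow \<Rightarrow> 'm \<Rightarrow> 'm) \<Rightarrow> bool" where
  "functor_to_Mod Ob Ar H Hmap \<longleftrightarrow>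
     (\<forall>\<T> \<in> Ob. Mod_object (fst \<T>) (H \<T>)) \<and>
     (\<forall>\<T> \<phi> \<T>'. (\<T>, \<phi>, \<T>') \<in> Ar \<longrightarrow>
        Mod_morphism (fst \<T>) \<phi> (H \<T>) (H \<T>') (Hmap (\<T>, \<phi>, \<T>'))) \<and>
     (\<forall>\<T> \<in> Ob. \<forall>x \<in> universe (H \<T>). Hmap (\<T>, id_translation, \<T>) x = x) \<and>
     (\<forall>\<T> \<phi> \<T>' \<psi> \<T>''. (\<T>, \<phi>, \<T>') \<in> Ar \<and> (\<T>', \<psi>, \<T>'') \<in> Ar \<longrightarrow>
        (\<forall>x \<in> universe (H \<T>). Hmap (\<T>, comp_translation \<psi> \<phi>, \<T>'') x =
           Hmap (\<T>', \<psi>, \<T>'') (Hmap (\<T>, \<phi>, \<T>') x)))"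

definition natural_transformation ::
  "('f, 'p) fo_theory set \<Rightarrow> ('f, 'p) th_arrow set \<Rightarrow>
   (('f, 'p) fo_theory \<Rightarrow> ('f, 'p, 'm) fo_struct) \<Rightarrow> (('f, 'p) th_arrow \<Rightarrow> 'm \<Rightarrow> 'm) \<Rightarrow>
   (('f, 'p) fo_theory \<Rightarrow> ('f, 'p, 'n) fo_struct) \<Rightarrow> (('f, 'p) th_arrow \<Rightarrow> 'n \<Rightarrow> 'n) \<Rightarrow>
   (('f, 'p) fo_theory \<Rightarrow> 'm \<Rightarrow> 'n) \<Rightarrow> bool" where
  "natural_transformation Ob Ar F Fmap G Gmap \<eta> \<longleftrightarrow>
     (\<forall>\<T> \<in> Ob. Mod_morphism (fst \<T>) id_translation (F \<T>) (G \<T>) (\<eta> \<T>)) \<and>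
     (\<forall>\<T> \<phi> \<T>'. (\<T>, \<phi>, \<T>') \<in> Ar \<longrightarrow>
        (\<forall>x \<in> universe (F \<T>).
           (\<eta> \<T>' \<circ> Fmap (\<T>, \<phi>, \<T>')) x = (Gmap (\<T>, \<phi>, \<T>') \<circ> \<eta> \<T>) x))"


section \<open>The Henkin construction\<close>

text \<open>The function symbols of \<open>\<L>\<^sup>*\<close>; \<open>Witness \<phi>\<close> is the constant \<open>c\<^sub>\<phi>\<close>.\<close>

datatype ('f, 'p) hsym = Sym 'f | Witness "('f, 'p) fm"

definition one_free_var :: "('f, 'p) signature \<Rightarrow> ('f, 'p) fm set" where
  "one_free_var \<Sigma> = {\<phi>. wf_fm \<Sigma> \<phi> \<and> fv_fm \<phi> = {0}}"

definition star_sig :: "('f, 'p) signature \<Rightarrow> (('f, 'p) hsym, 'p) signature" where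
  "star_sig \<Sigma> = \<lparr>
     fun_ar = (\<lambda>s. case s of Sym f \<Rightarrow> fun_ar \<Sigma> f
                    | Witness \<phi> \<Rightarrow> if \<phi> \<in> one_free_var \<Sigma> then Some 0 else None),
     rel_ar = rel_ar \<Sigma>\<rparr>"

definition embed :: "('f, 'p) fm \<Rightarrow> (('f, 'p) hsym, 'p) fm" where
  "embed = map_fm Sym id"

definition henkin_completion ::
  "('f, 'p) fo_theory \<Rightarrow> (('f, 'p) hsym, 'p) fm set \<Rightarrow> bool" where
  "henkin_completion = (\<lambda>(\<Sigma>, T) S.
     maximal_consistent (star_sig \<Sigma>) S \<and> embed ` T \<subseteq> S \<and>
     (\<forall>\<phi> \<in> one_free_var \<Sigma>. derives \<Sigma> T (Exists \<phi>) \<longrightarrow>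
        derives (star_sig \<Sigma>) S (inst (embed \<phi>) (Fn (Witness \<phi>) []))))"

definition henkin_terms :: "('f, 'p) fo_theory \<Rightarrow> ('f, 'p) hsym tm set" where
  "henkin_terms \<T> = closed_terms (star_sig (fst \<T>))"

text \<open>In the following \<open>star \<T>\<close> is the chosen completion \<open>T\<^sup>*\<close>.\<close>

type_synonym ('f, 'p) star = "('f, 'p) fo_theory \<Rightarrow> (('f, 'p) hsym, 'p) fm set"

definition term_equiv :: "('f, 'p) star \<Rightarrow> ('f, 'p) fo_theory \<Rightarrow> ('f, 'p) hsym tm rel" where
  "term_equiv star \<T> = {(t, s). t \<in> henkin_terms \<T> \<and> s \<in> henkin_terms \<T> \<and>
     derives (star_sig (fst \<T>)) (star \<T>) (Eq t s)}"

definition term_class ::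
  "('f, 'p) star \<Rightarrow> ('f, 'p) fo_theory \<Rightarrow> ('f, 'p) hsym tm \<Rightarrow> ('f, 'p) hsym tm set" where
  "term_class star \<T> t = term_equiv star \<T> `` {t}"

text \<open>
  Operations on classes are defined from all choices of representatives \<open>ts \<in> listset Xs\<close> at once;
  since they respect the equivalence, the unions below are unions of a single class.
\<close>

definition henkin_model ::
  "('f, 'p) star \<Rightarrow> ('f, 'p) fo_theory \<Rightarrow> ('f, 'p, ('f, 'p) hsym tm set) fo_struct" where
  "henkin_model star \<T> = \<lparr>
     universe = henkin_terms \<T> // term_equiv star \<T>,
     fun_int = (\<lambda>f Xs. \<Union>ts \<in> listset Xs. term_class star \<T> (Fn (Sym f) ts)),
     rel_int = (\<lambda>P Xs. \<exists>ts \<in> listset Xs. derives (star_sig (fst \<T>)) (star \<T>) (Rel P ts))\<rparr>"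

text \<open>
  \<open>ext (\<T>, \<phi>, \<T>')\<close> extends the translation \<open>\<phi>\<close> to closed \<open>\<L>\<^sup>*\<close>-terms. It is prescribed on the
  symbols of \<open>\<L>\<close>; the images of the new constants are unconstrained.
\<close>

type_synonym ('f, 'p) term_ext = "('f, 'p) th_arrow \<Rightarrow> ('f, 'p) hsym tm \<Rightarrow> ('f, 'p) hsym tm"

definition extends_translation ::
  "('f, 'p) th_arrow \<Rightarrow> (('f, 'p) hsym tm \<Rightarrow> ('f, 'p) hsym tm) \<Rightarrow> bool" where
  "extends_translation = (\<lambda>(\<T>, \<phi>, \<T>') \<tau>.
     \<tau> ` henkin_terms \<T> \<subseteq> henkin_terms \<T>' \<and>
     (\<forall>f ts. Fn (Sym f) ts \<in> henkin_terms \<T> \<longrightarrow>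
        \<tau> (Fn (Sym f) ts) = Fn (Sym (on_fun \<phi> f)) (map \<tau> ts)))"

definition henkin_construction ::
  "('f, 'p) fo_theory set \<Rightarrow> ('f, 'p) th_arrow set \<Rightarrow> ('f, 'p) star \<Rightarrow> ('f, 'p) term_ext \<Rightarrow> bool" where
  "henkin_construction Ob Ar star ext \<longleftrightarrow>
     (\<forall>\<T> \<in> Ob. henkin_completion \<T> (star \<T>)) \<and>
     (\<forall>\<T> \<phi> \<T>'. (\<T>, \<phi>, \<T>') \<in> Ar \<longrightarrow>
        extends_translation (\<T>, \<phi>, \<T>') (ext (\<T>, \<phi>, \<T>')) \<and>
        (\<forall>t s. (t, s) \<in> term_equiv star \<T> \<longrightarrow>
           (ext (\<T>, \<phi>, \<T>') t, ext (\<T>, \<phi>, \<T>') s) \<in> term_equiv star \<T>'))"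

definition henkin_map ::
  "('f, 'p) star \<Rightarrow> ('f, 'p) term_ext \<Rightarrow> ('f, 'p) th_arrow \<Rightarrow>
   ('f, 'p) hsym tm set \<Rightarrow> ('f, 'p) hsym tm set" where
  "henkin_map star ext = (\<lambda>(\<T>, \<phi>, \<T>') X. \<Union>t \<in> X. term_class star \<T>' (ext (\<T>, \<phi>, \<T>') t))"


section \<open>The compactness and saturation constructions\<close>

definition ultrafilter_on :: "'i set \<Rightarrow> 'i set set \<Rightarrow> bool" where
  "ultrafilter_on I U \<longleftrightarrow> U \<subseteq> Pow I \<and> I \<in> U \<and> {} \<notin> U \<and>
     (\<forall>A \<in> U. \<forall>B \<in> U. A \<inter> B \<in> U) \<and>
     (\<forall>A \<in> U. \<forall>B. A \<subseteq> B \<and> B \<subseteq> I \<longrightarrow> B \<in> U) \<and>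
     (\<forall>A. A \<subseteq> I \<longrightarrow> A \<in> U \<or> I - A \<in> U)"

definition nonprincipal_on :: "'i set \<Rightarrow> 'i set set \<Rightarrow> bool" where
  "nonprincipal_on I U \<longleftrightarrow> \<not> (\<exists>i \<in> I. U = {A. A \<subseteq> I \<and> i \<in> A})"

definition ultra_equiv ::
  "'i set \<Rightarrow> 'i set set \<Rightarrow> ('i \<Rightarrow> ('f, 'p, 'm) fo_struct) \<Rightarrow> ('i \<Rightarrow> 'm) rel" where
  "ultra_equiv I U M = {(a, b). a \<in> (\<Pi>\<^sub>E i\<in>I. universe (M i)) \<and> b \<in> (\<Pi>\<^sub>E i\<in>I. universe (M i)) \<and>
     {i \<in> I. a i = b i} \<in> U}"

definition ultraproduct ::
  "'i set \<Rightarrow> 'i set set \<Rightarrow> ('i \<Rightarrow> ('f, 'p, 'm) fo_struct) \<Rightarrow> ('f, 'p, ('i \<Rightarrow> 'm) set) fo_struct" where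
  "ultraproduct I U M = \<lparr>
     universe = (\<Pi>\<^sub>E i\<in>I. universe (M i)) // ultra_equiv I U M,
     fun_int = (\<lambda>f Xs. \<Union>as \<in> listset Xs.
        ultra_equiv I U M `` {\<lambda>i\<in>I. fun_int (M i) f (map (\<lambda>a. a i) as)}),
     rel_int = (\<lambda>P Xs. \<exists>as \<in> listset Xs. {i \<in> I. rel_int (M i) P (map (\<lambda>a. a i) as)} \<in> U)\<rparr>"

text \<open>
  A \<open>1\<close>-type over \<open>A\<close> is a set of pairs \<open>(\<phi>, e)\<close> standing for the formula \<open>\<phi>(x, e 0, e 1, \<dots>)\<close>
  with parameters \<open>e n \<in> A\<close> for those variables \<open>Suc n\<close> that occur free in \<open>\<phi>\<close>.
\<close>

definition one_type_over ::
  "('f, 'p) signature \<Rightarrow> ('f, 'p, 'm) fo_struct \<Rightarrow> 'm set \<Rightarrow> (('f, 'p) fm \<times> (nat \<Rightarrow> 'm)) set \<Rightarrow> bool" where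
  "one_type_over \<Sigma> M A p \<longleftrightarrow>
     (\<forall>(\<phi>, e) \<in> p. wf_fm \<Sigma> \<phi> \<and> (\<forall>n. Suc n \<in> fv_fm \<phi> \<longrightarrow> e n \<in> A)) \<and>
     (\<forall>q. finite q \<and> q \<subseteq> p \<longrightarrow> (\<exists>x \<in> universe M. \<forall>(\<phi>, e) \<in> q. sat M (case_nat x e) \<phi>))"

definition saturated ::
  "('f, 'p) signature \<Rightarrow> 'k rel \<Rightarrow> ('f, 'p, 'm) fo_struct \<Rightarrow> bool" where
  "saturated \<Sigma> \<kappa> M \<longleftrightarrow> (\<forall>A p. A \<subseteq> universe M \<and> |A| <o \<kappa> \<and> one_type_over \<Sigma> M A p \<longrightarrow>
     (\<exists>x \<in> universe M. \<forall>(\<phi>, e) \<in> p. sat M (case_nat x e) \<phi>))"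

definition ultraproduct_model ::
  "'i itself \<Rightarrow> 'm itself \<Rightarrow> ('f, 'p) fo_theory \<Rightarrow> ('f, 'p, 'g) fo_struct \<Rightarrow> bool" where
  "ultraproduct_model _ _ = (\<lambda>(\<Sigma>, T) N. is_model (\<Sigma>, T) N \<and>
     (\<exists>(I :: 'i set) U (M :: 'i \<Rightarrow> ('f, 'p, 'm) fo_struct).
        ultrafilter_on I U \<and> nonprincipal_on I U \<and>
        (\<forall>i \<in> I. \<exists>T\<^sub>0. finite T\<^sub>0 \<and> T\<^sub>0 \<subseteq> T \<and> is_model (\<Sigma>, T\<^sub>0) (M i)) \<and>
        isomorphic \<Sigma> N (ultraproduct I U M)))"

text \<open>``Sufficiently large'': \<open>\<kappa>\<close> exceeds the cardinality of the language.\<close>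

definition saturated_model ::
  "'k itself \<Rightarrow> ('f, 'p) fo_theory \<Rightarrow> ('f, 'p, 'g) fo_struct \<Rightarrow> bool" where
  "saturated_model _ = (\<lambda>(\<Sigma>, T) N. is_model (\<Sigma>, T) N \<and>
     (\<exists>\<kappa> :: 'k rel. Card_order \<kappa> \<and> |{\<phi>. wf_fm \<Sigma> \<phi>}| <o \<kappa> \<and> saturated \<Sigma> \<kappa> N))"

text \<open>
  \<open>\<L>\<^sup>*\<close>-terms contain the constants \<open>c\<^sub>\<phi>\<close>, so in order to evaluate them in an \<open>\<L>\<close>-structure
  one needs an interpretation \<open>w\<close> of these constants.
\<close>

definition expand ::
  "('f, 'p, 'g) fo_struct \<Rightarrow> (('f, 'p) fm \<Rightarrow> 'g) \<Rightarrow> (('f, 'p) hsym, 'p, 'g) fo_struct" where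
  "expand N w = \<lparr>
     universe = universe N,
     fun_int = (\<lambda>s xs. case s of Sym f \<Rightarrow> fun_int N f xs | Witness \<phi> \<Rightarrow> w \<phi>),
     rel_int = rel_int N\<rparr>"

text \<open>
  \<open>\<K> \<T>\<close> is the class of models of \<open>\<T>\<close> that the construction yields; by canonicity it is contained
  in one isomorphism class. \<open>G \<T>\<close> is one of these models, and \<open>wit \<T>\<close> interprets the constants
  \<open>c\<^sub>\<phi>\<close> in it in such a way that \<open>T\<^sup>*\<close> holds.
\<close>

definition compactness_construction ::
  "'i itself \<Rightarrow> 'm itself \<Rightarrow> 'k itself \<Rightarrow> ('f, 'p) fo_theory set \<Rightarrow> ('f, 'p) star \<Rightarrow>
   (('f, 'p) fo_theory \<Rightarrow> ('f, 'p, 'g) fo_struct set) \<Rightarrow>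
   (('f, 'p) fo_theory \<Rightarrow> ('f, 'p, 'g) fo_struct) \<Rightarrow>
   (('f, 'p) fo_theory \<Rightarrow> ('f, 'p) fm \<Rightarrow> 'g) \<Rightarrow> bool" where
  "compactness_construction ti tm tk Ob star \<K> G wit \<longleftrightarrow>
     (\<forall>\<T> \<in> Ob.
        (\<forall>N \<in> \<K> \<T>. ultraproduct_model ti tm \<T> N \<or> saturated_model tk \<T> N) \<and>
        (\<forall>N \<in> \<K> \<T>. \<forall>N' \<in> \<K> \<T>. isomorphic (fst \<T>) N N') \<and>
        G \<T> \<in> \<K> \<T> \<and>
        is_model (star_sig (fst \<T>), star \<T>) (expand (G \<T>) (wit \<T>)))"

definition term_value ::
  "(('f, 'p) fo_theory \<Rightarrow> ('f, 'p, 'g) fo_struct) \<Rightarrow> (('f, 'p) fo_theory \<Rightarrow> ('f, 'p) fm \<Rightarrow> 'g) \<Rightarrow>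
   ('f, 'p) fo_theory \<Rightarrow> ('f, 'p) hsym tm \<Rightarrow> 'g" where
  "term_value G wit \<T> t = denotation (expand (G \<T>) (wit \<T>)) t"

definition semantic_map ::
  "('f, 'p) th_arrow set \<Rightarrow> ('f, 'p) term_ext \<Rightarrow>
   (('f, 'p) fo_theory \<Rightarrow> ('f, 'p, 'g) fo_struct) \<Rightarrow> (('f, 'p) fo_theory \<Rightarrow> ('f, 'p) fm \<Rightarrow> 'g) \<Rightarrow>
   (('f, 'p) th_arrow \<Rightarrow> 'g \<Rightarrow> 'g) \<Rightarrow> bool" where
  "semantic_map Ar ext G wit Gmap \<longleftrightarrow>
     (\<forall>\<T> \<phi> \<T>'. (\<T>, \<phi>, \<T>') \<in> Ar \<longrightarrow>
        (\<forall>t \<in> henkin_terms \<T>. Gmap (\<T>, \<phi>, \<T>') (term_value G wit \<T> t) =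
           term_value G wit \<T>' (ext (\<T>, \<phi>, \<T>') t)))"


section \<open>The comparison of the two constructions\<close>

text \<open>
  The component at \<open>\<T>\<close> sends a class to the common value of its elements; \<open>the_elem\<close> is
  meaningful only if all elements of the class have the same value.
\<close>

definition eta ::
  "(('f, 'p) fo_theory \<Rightarrow> ('f, 'p, 'g) fo_struct) \<Rightarrow> (('f, 'p) fo_theory \<Rightarrow> ('f, 'p) fm \<Rightarrow> 'g) \<Rightarrow>
   ('f, 'p) fo_theory \<Rightarrow> ('f, 'p) hsym tm set \<Rightarrow> 'g" where
  "eta G wit \<T> X = the_elem (term_value G wit \<T> ` X)"

end

theory Submission
  imports Defs
begin

text \<open>
  By soundness of the calculus, \<open>T\<^sup>* \<turnstile> t = s\<close> forces \<open>t\<close> and \<open>s\<close> to have the same value in the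
  expansion of \<open>G(T)\<close>, which is a model of \<open>T\<^sup>*\<close>. So all elements of a class, and all
  representatives entering an operation of the Henkin model, have one common value. Hence \<open>\<eta>\<^sub>T\<close> is
  well defined and a homomorphism, and both sides of the naturality square send \<open>[t]\<close> to
  \<open>\<lbrakk>\<phi>(t)\<rbrakk>\<close>.
\<close>

section \<open>Substitution, evaluation and soundness\<close>

lemma eval_subst_tm: "eval M e (subst_tm \<theta> t) = eval M (\<lambda>n. eval M e (\<theta> n)) t"
  by (induction t) (auto simp: comp_def intro!: arg_cong[where f = "fun_int M _"])

lemma eval_lift_tm: "eval M (case_nat x e) (lift_tm t) = eval M e t"
  by (simp add: lift_tm_def eval_subst_tm)

lemma sat_subst_fm: "sat M e (subst_fm \<theta> \<phi>) \<longleftrightarrow> sat M (\<lambda>n. eval M e (\<theta> n)) \<phi>"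
proof (induction \<phi> arbitrary: e \<theta>)
  case (Forall \<phi>)
  \<comment> \<open>Lifting compensates for the de Bruijn shift: below the quantifier the values of
    the substituted terms reappear moved up by one, with \<open>x\<close> in front, so the induction
    hypothesis must allow any \<open>e\<close> and \<open>\<theta>\<close>.\<close>
  have "(\<lambda>n. eval M (case_nat x e) (case_nat (Var 0) (\<lambda>n. lift_tm (\<theta> n)) n))
      = case_nat x (\<lambda>n. eval M e (\<theta> n))" for x
    by (auto simp: eval_lift_tm split: nat.split)
  then show ?case
    by (simp add: Forall.IH)
qed (auto simp: eval_subst_tm comp_def)

lemma sat_lift_fm: "sat M (case_nat x e) (lift_fm \<phi>) \<longleftrightarrow> sat M e \<phi>"
  by (simp add: lift_fm_def sat_subst_fm)

lemma sat_inst: "sat M e (inst \<phi> t) \<longleftrightarrow> sat M (case_nat (eval M e t) e) \<phi>"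
proof -
  have "(\<lambda>n. eval M e (case_nat t Var n)) = case_nat (eval M e t) e"
    by (auto split: nat.split)
  then show ?thesis
    by (simp add: inst_def sat_subst_fm)
qed

lemma eval_cong_fv: "(\<And>n. n \<in> fv_tm t \<Longrightarrow> e n = e' n) \<Longrightarrow> eval M e t = eval M e' t"
proof (induction t)
  case (Fn f ts)
  then have "map (eval M e) ts = map (eval M e') ts"
    by fastforce
  then show ?case
    by (simp only: eval.simps)
qed simp

text \<open>Quantifiers range over the universe only, so soundness of \<open>ForallE\<close> needs
  the value of the instantiating term to lie there.\<close>

lemma eval_in_universe:
  assumes "is_struct \<Sigma> M" "range e \<subseteq> universe M"
  shows "wf_tm \<Sigma> t \<Longrightarrow> eval M e t \<in> universe M"
proof (induction t)
  case (Fn f ts)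
  then have "map (eval M e) ts \<in> tuples M (length ts)"
    by (auto simp: tuples_def list_all_iff)
  with Fn.prems assms(1) show ?case
    by (simp add: is_struct_def)
qed (use assms(2) in \<open>auto simp: image_subset_iff\<close>)

text \<open>Induction with \<open>e\<close> arbitrary, since \<open>ForallI\<close> passes to
  \<open>case_nat x e\<close>, in which the lifted assumptions keep their truth values; taking
  \<open>x\<close> from the universe preserves the range condition.\<close>

lemma soundness:
  assumes "derives \<Sigma> \<Gamma> \<phi>" and M: "is_struct \<Sigma> M"
    and "range e \<subseteq> universe M" "\<forall>\<gamma>\<in>\<Gamma>. sat M e \<gamma>"
  shows "sat M e \<phi>"
  using assms(1,3,4)
proof (induction arbitrary: e rule: derives.induct)
  case (RAA \<phi> \<Gamma>)
  then show ?case
    by (auto simp: Neg_def)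
next
  case (ForallI \<Gamma> \<phi>)
  have "sat M (case_nat x e) \<phi>" if "x \<in> universe M" for x
  proof (rule ForallI.IH)
    show "range (case_nat x e) \<subseteq> universe M"
      using that ForallI.prems(1) by (auto simp: image_subset_iff split: nat.split)
    show "\<forall>\<gamma>\<in>lift_fm ` \<Gamma>. sat M (case_nat x e) \<gamma>"
      using ForallI.prems(2) by (simp add: sat_lift_fm)
  qed
  then show ?case
    by simp
next
  case (ForallE \<Gamma> \<phi> t)
  then show ?case
    using eval_in_universe[OF M] by (auto simp: sat_inst)
next
  case (EqE \<Gamma> s t \<phi>)
  then show ?case
    by (simp add: sat_inst)
qed auto

section \<open>Closed terms and representatives of classes\<close>

text \<open>\<open>denotation\<close> evaluates at \<open>undefined\<close>, which may lie outside
  the universe, where \<open>soundness\<close> does not apply. Closedness permits a change to an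
  environment inside it.\<close>

lemma eval_eq_denotation: "fv_tm t = {} \<Longrightarrow> eval M e t = denotation M t"
  unfolding denotation_def by (rule eval_cong_fv) simp

text \<open>The member \<open>x\<close> excludes the empty image, on which \<open>the_elem\<close>
  is unspecified.\<close>

lemma the_elem_constant_image:
  assumes "x \<in> A" "\<And>y. y \<in> A \<Longrightarrow> f y = c"
  shows "the_elem (f ` A) = c"
proof -
  have "f ` A = {c}"
    using assms by force
  then show ?thesis
    by simp
qed

lemma listset_iff_list_all2: "xs \<in> listset As \<longleftrightarrow> list_all2 (\<in>) xs As"
  by (induction As arbitrary: xs) (auto simp: set_Cons_def list_all2_Cons2)

lemma universe_expand [simp]: "universe (expand N w) = universe N"
  by (simp add: expand_def)

lemma fun_int_expand_Sym [simp]: "fun_int (expand N w) (Sym f) = fun_int N f"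
  by (simp add: expand_def)

lemma rel_int_expand [simp]: "rel_int (expand N w) = rel_int N"
  by (simp add: expand_def)

lemma term_class_self:
  assumes "t \<in> henkin_terms \<T>"
  shows "t \<in> term_class star \<T> t"
  using assms
  by (auto simp: term_class_def term_equiv_def henkin_terms_def closed_terms_def intro: EqI)

lemma henkin_universe_cases:
  assumes "X \<in> universe (henkin_model star \<T>)"
  obtains t where "t \<in> henkin_terms \<T>" "X = term_class star \<T> t"
  using assms by (auto simp: henkin_model_def term_class_def elim: quotientE)

text \<open>Reflexivity of provable equality puts each term in its own class, so classes are
  nonempty and the union defining an operation of the Henkin model has at least one index.\<close>

lemma listset_henkin_nonempty:
  assumes "set Xs \<subseteq> universe (henkin_model star \<T>)"
  obtains ts where "ts \<in> listset Xs"
proof -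
  have "\<forall>X\<in>set Xs. \<exists>t. t \<in> X"
    using term_class_self by (blast dest!: subsetD[OF assms] elim: henkin_universe_cases)
  then obtain r where "\<forall>X\<in>set Xs. r X \<in> X"
    by metis
  then have "map r Xs \<in> listset Xs"
    by (auto simp: listset_iff_list_all2 list_all2_conv_all_nth)
  then show thesis
    by (rule that)
qed

lemma term_value_Sym:
  "term_value G wit \<T> (Fn (Sym f) ts) = fun_int (G \<T>) f (map (term_value G wit \<T>) ts)"
  by (simp add: term_value_def[abs_def] denotation_def[abs_def])

lemma Fn_Sym_henkin_terms:
  assumes "fun_ar (fst \<T>) f = Some (length ts)" "set ts \<subseteq> henkin_terms \<T>"
  shows "Fn (Sym f) ts \<in> henkin_terms \<T>"
  using assms by (auto simp: henkin_terms_def closed_terms_def star_sig_def list_all_iff)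

lemma term_value_in_universe:
  assumes "is_struct (star_sig (fst \<T>)) (expand (G \<T>) (wit \<T>))" "t \<in> henkin_terms \<T>"
  shows "term_value G wit \<T> t \<in> universe (G \<T>)"
proof -
  obtain x where x: "x \<in> universe (G \<T>)"
    using assms(1) by (auto simp: is_struct_def)
  have "eval (expand (G \<T>) (wit \<T>)) (\<lambda>_. x) t \<in> universe (G \<T>)"
    using eval_in_universe[OF assms(1)] assms(2) x
    by (auto simp: henkin_terms_def closed_terms_def)
  then show ?thesis
    using assms(2) by (simp add: term_value_def henkin_terms_def closed_terms_def eval_eq_denotation)
qed

text \<open>An environment constant at a point of the nonempty universe meets the range condition.
  Which \<open>e\<close> results is immaterial for atoms built from closed terms.\<close>

lemma soundness_closed:
  assumes "is_model (\<Sigma>, T) M" "derives \<Sigma> T \<phi>"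
  obtains e where "sat M e \<phi>"
proof -
  obtain x where "x \<in> universe M"
    using assms(1) by (auto simp: is_model_def is_struct_def)
  then have "sat M (\<lambda>_. x) \<phi>"
    using assms(1) by (intro soundness[OF assms(2)]) (auto simp: is_model_def)
  then show thesis
    by (rule that)
qed

section \<open>The component at a single theory\<close>

context
  fixes \<T> :: "('f, 'p) fo_theory"
    and star :: "('f, 'p) star"
    and G :: "('f, 'p) fo_theory \<Rightarrow> ('f, 'p, 'g) fo_struct"
    and wit :: "('f, 'p) fo_theory \<Rightarrow> ('f, 'p) fm \<Rightarrow> 'g"
  assumes model: "is_model (star_sig (fst \<T>), star \<T>) (expand (G \<T>) (wit \<T>))"
begin

lemma term_value_cong:
  assumes "(t, s) \<in> term_equiv star \<T>"
  shows "term_value G wit \<T> s = term_value G wit \<T> t"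
proof -
  have closed: "fv_tm t = {}" "fv_tm s = {}"
    using assms by (auto simp: term_equiv_def henkin_terms_def closed_terms_def)
  have "derives (star_sig (fst \<T>)) (star \<T>) (Eq t s)"
    using assms by (simp add: term_equiv_def)
  with model obtain e where "sat (expand (G \<T>) (wit \<T>)) e (Eq t s)"
    by (rule soundness_closed)
  then show ?thesis
    by (simp add: term_value_def eval_eq_denotation closed)
qed

lemma eta_term_class:
  assumes "t \<in> henkin_terms \<T>"
  shows "eta G wit \<T> (term_class star \<T> t) = term_value G wit \<T> t"
  unfolding eta_def
proof (rule the_elem_constant_image)
  show "t \<in> term_class star \<T> t"
    by (rule term_class_self) fact
  show "term_value G wit \<T> s = term_value G wit \<T> t" if "s \<in> term_class star \<T> t" for s
    using that by (intro term_value_cong assms) (simp add: term_class_def)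
qed

text \<open>Lets every member of \<open>X\<close> serve as representative: the Henkin operations and
  \<open>henkin_map\<close> range over all members of a class, not over a chosen one.\<close>

lemma eta_of_member:
  assumes "X \<in> universe (henkin_model star \<T>)" "s \<in> X"
  shows "s \<in> henkin_terms \<T>" "eta G wit \<T> X = term_value G wit \<T> s"
proof -
  obtain t where t: "t \<in> henkin_terms \<T>" "X = term_class star \<T> t"
    using assms(1) by (rule henkin_universe_cases)
  with assms(2) have ts: "(t, s) \<in> term_equiv star \<T>"
    by (simp add: term_class_def)
  then show "s \<in> henkin_terms \<T>"
    by (simp add: term_equiv_def)
  show "eta G wit \<T> X = term_value G wit \<T> s"
    using t eta_term_class term_value_cong[OF ts]
    by simp
qed

text \<open>The right-hand side of the last claim does not mention \<open>ts\<close>: this is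
  independence of representatives for a whole argument tuple.\<close>

lemma henkin_representatives:
  assumes "set Xs \<subseteq> universe (henkin_model star \<T>)" "ts \<in> listset Xs"
  shows "length ts = length Xs" "set ts \<subseteq> henkin_terms \<T>"
    and "map (term_value G wit \<T>) ts = map (eta G wit \<T>) Xs"
proof -
  have all2: "list_all2 (\<in>) ts Xs"
    using assms(2) by (simp add: listset_iff_list_all2)
  then show len: "length ts = length Xs"
    by (rule list_all2_lengthD)
  have nth: "ts ! i \<in> Xs ! i" "Xs ! i \<in> universe (henkin_model star \<T>)" if "i < length Xs" for i
    using all2 that assms(1) len by (auto simp: list_all2_conv_all_nth)
  show "set ts \<subseteq> henkin_terms \<T>"
    using eta_of_member(1)[OF nth(2) nth(1)] len by (auto simp: in_set_conv_nth)
  show "map (term_value G wit \<T>) ts = map (eta G wit \<T>) Xs"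
    using eta_of_member(2)[OF nth(2) nth(1)] len by (intro nth_equalityI) auto
qed

lemma eta_Mod_morphism:
  "Mod_morphism (fst \<T>) id_translation (henkin_model star \<T>) (G \<T>) (eta G wit \<T>)"
  unfolding Mod_morphism_def
proof (intro conjI allI impI ballI)
  have "is_struct (star_sig (fst \<T>)) (expand (G \<T>) (wit \<T>))"
    using model by (simp add: is_model_def)
  then show "eta G wit \<T> ` universe (henkin_model star \<T>) \<subseteq> universe (G \<T>)"
    by (auto elim!: henkin_universe_cases simp: eta_term_class term_value_in_universe)
next
  fix f n Xs
  assume ar: "fun_ar (fst \<T>) f = Some n" and Xs: "Xs \<in> tuples (henkin_model star \<T>) n"
  then have sub: "set Xs \<subseteq> universe (henkin_model star \<T>)" and len: "length Xs = n"
    by (auto simp: tuples_def)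
  have mem: "Fn (Sym f) ts \<in> henkin_terms \<T>" if "ts \<in> listset Xs" for ts
    using henkin_representatives(1,2)[OF sub that] ar len
    by (intro Fn_Sym_henkin_terms) auto
  obtain ts where ts: "ts \<in> listset Xs"
    using sub by (rule listset_henkin_nonempty)
  show "eta G wit \<T> (fun_int (henkin_model star \<T>) f Xs)
      = fun_int (G \<T>) (on_fun id_translation f) (map (eta G wit \<T>) Xs)"
    \<comment> \<open>The operation yields a union over all choices of representatives, so constancy
      of the value is checked on the whole union; the fixed \<open>ts\<close> shows that it is
      nonempty.\<close>
    unfolding eta_def[of G wit \<T> "fun_int _ _ _"]
  proof (rule the_elem_constant_image)
    show "Fn (Sym f) ts \<in> fun_int (henkin_model star \<T>) f Xs"
      using ts term_class_self[OF mem[OF ts]] by (auto simp: henkin_model_def)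
    fix s assume "s \<in> fun_int (henkin_model star \<T>) f Xs"
    then obtain us where us: "us \<in> listset Xs" "(Fn (Sym f) us, s) \<in> term_equiv star \<T>"
      by (auto simp: henkin_model_def term_class_def)
    \<comment> \<open>The value of \<open>s\<close> depends on \<open>us\<close> only through the
      values of its entries, and these are the images of \<open>Xs\<close> under
      \<open>eta\<close>.\<close>
    then have "term_value G wit \<T> s = fun_int (G \<T>) f (map (term_value G wit \<T>) us)"
      by (simp add: term_value_cong[OF us(2)] term_value_Sym)
    then show "term_value G wit \<T> s
        = fun_int (G \<T>) (on_fun id_translation f) (map (eta G wit \<T>) Xs)"
      using henkin_representatives(3)[OF sub us(1)] by (simp add: id_translation_def)
  qed
next
  fix P n Xs
  assume Xs: "Xs \<in> tuples (henkin_model star \<T>) n"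
    and "rel_int (henkin_model star \<T>) P Xs"
  then obtain ts where ts: "ts \<in> listset Xs"
    and der: "derives (star_sig (fst \<T>)) (star \<T>) (Rel P ts)"
    by (auto simp: henkin_model_def)
  have sub: "set Xs \<subseteq> universe (henkin_model star \<T>)"
    using Xs by (simp add: tuples_def)
  from model der obtain e where sat: "sat (expand (G \<T>) (wit \<T>)) e (Rel P ts)"
    by (rule soundness_closed)
  \<comment> \<open>The entries of \<open>ts\<close> are closed, so \<open>e\<close> can be
    exchanged for the environment used by \<open>denotation\<close>.\<close>
  have "map (eval (expand (G \<T>) (wit \<T>)) e) ts = map (term_value G wit \<T>) ts"
    using henkin_representatives(2)[OF sub ts]
    by (auto simp: henkin_terms_def closed_terms_def term_value_def eval_eq_denotation)
  with sat have "rel_int (G \<T>) P (map (term_value G wit \<T>) ts)"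
    by simp
  then show "rel_int (G \<T>) (on_rel id_translation P) (map (eta G wit \<T>) Xs)"
    using henkin_representatives(3)[OF sub ts] by (simp add: id_translation_def)
qed

end

section \<open>Naturality along all arrows\<close>

theorem theorem4p4:
  fixes Ob :: "('f, 'p) fo_theory set"
    and Ar :: "('f, 'p) th_arrow set"
    and star :: "('f, 'p) star"
    and ext :: "('f, 'p) term_ext"
    and \<K> :: "('f, 'p) fo_theory \<Rightarrow> ('f, 'p, 'g) fo_struct set"
    and G :: "('f, 'p) fo_theory \<Rightarrow> ('f, 'p, 'g) fo_struct"
    and wit :: "('f, 'p) fo_theory \<Rightarrow> ('f, 'p) fm \<Rightarrow> 'g"
    and Gmap :: "('f, 'p) th_arrow \<Rightarrow> 'g \<Rightarrow> 'g"
  assumes "subcategory_of_Th Ob Ar"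
    and "henkin_construction Ob Ar star ext"
    and "functor_to_Mod Ob Ar (henkin_model star) (henkin_map star ext)"
    and "compactness_construction TYPE('i) TYPE('m) TYPE('k) Ob star \<K> G wit"
    and "functor_to_Mod Ob Ar G Gmap"
    and "semantic_map Ar ext G wit Gmap"
  shows "(\<forall>\<T> \<in> Ob. \<forall>t \<in> henkin_terms \<T>.
            eta G wit \<T> (term_class star \<T> t) = term_value G wit \<T> t) \<and>
         natural_transformation Ob Ar (henkin_model star) (henkin_map star ext) G Gmap (eta G wit)"
proof -
  have model: "is_model (star_sig (fst \<T>), star \<T>) (expand (G \<T>) (wit \<T>))" if "\<T> \<in> Ob" for \<T>
    using assms(4) that by (simp add: compactness_construction_def)
  have natural: "eta G wit \<T>' (henkin_map star ext (\<T>, \<phi>, \<T>') X)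
      = Gmap (\<T>, \<phi>, \<T>') (eta G wit \<T> X)"
    if ar: "(\<T>, \<phi>, \<T>') \<in> Ar" and X: "X \<in> universe (henkin_model star \<T>)" for \<T> \<phi> \<T>' X
  proof -
    have Ob: "\<T> \<in> Ob" "\<T>' \<in> Ob"
      using assms(1) ar unfolding subcategory_of_Th_def by blast+
    obtain t where t: "t \<in> henkin_terms \<T>" "X = term_class star \<T> t"
      using X by (rule henkin_universe_cases)
    have ext: "ext (\<T>, \<phi>, \<T>') s \<in> henkin_terms \<T>'" if "s \<in> henkin_terms \<T>" for s
      using assms(2) ar that
      unfolding henkin_construction_def extends_translation_def by blast
    have tX: "t \<in> X"
      using t term_class_self by simp
    show ?thesis
      \<comment> \<open>Only the component at \<open>\<T>'\<close> is unfolded; the one at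
        \<open>\<T>\<close> stays folded until a representative of \<open>X\<close> is
        known.\<close>
      unfolding eta_def[of G wit \<T>']
    proof (rule the_elem_constant_image)
      show "ext (\<T>, \<phi>, \<T>') t \<in> henkin_map star ext (\<T>, \<phi>, \<T>') X"
        using tX term_class_self[OF ext[OF t(1)]] by (auto simp: henkin_map_def)
      fix u assume "u \<in> henkin_map star ext (\<T>, \<phi>, \<T>') X"
      then obtain s where s: "s \<in> X" and u: "(ext (\<T>, \<phi>, \<T>') s, u) \<in> term_equiv star \<T>'"
        by (auto simp: henkin_map_def term_class_def)
      \<comment> \<open>The union in \<open>henkin_map\<close> produces some member \<open>s\<close>
        of \<open>X\<close>, possibly different from \<open>t\<close>, so \<open>eta\<close> at
        \<open>\<T>\<close> is read off at \<open>s\<close>.\<close>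
      note s' = eta_of_member[where star = star and G = G and wit = wit, OF model[OF Ob(1)] X s]
      have "term_value G wit \<T>' u = term_value G wit \<T>' (ext (\<T>, \<phi>, \<T>') s)"
        using model[OF Ob(2)] u by (rule term_value_cong)
      \<comment> \<open>Here the square closes: \<open>semantic_map\<close> prescribes
        \<open>Gmap\<close> on values of closed terms, and \<open>s\<close> is one.\<close>
      also have "\<dots> = Gmap (\<T>, \<phi>, \<T>') (term_value G wit \<T> s)"
        using assms(6) ar s'(1) unfolding semantic_map_def by metis
      finally show "term_value G wit \<T>' u = Gmap (\<T>, \<phi>, \<T>') (eta G wit \<T> X)"
        using s'(2) by simp
    qed
  qed
  show ?thesis
    unfolding natural_transformation_def
    using eta_term_class[where star = star and G = G and wit = wit, OF model]
      eta_Mod_morphism[where star = star and G = G and wit = wit, OF model] natural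
    by simp
qed

end
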